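(* Let $\beta$ be a topological $\mathbb{Z}^d$-action on an infinite compact metric space. Then $\operatorname{entrk}(\beta)\le\operatorname{exprk}(\beta)$.
   Context: A topological $\mathbb{Z}^d$-action $\beta$ on a compact metric space $(X,\rho)$ is a homomorphism $\mathbf{n}\mapsto\beta^{\mathbf{n}}$ from $\mathbb{Z}^d$ to the group of homeomorphisms of $X$. For $F\subset\mathbb{R}^d$, put $\rho_\beta^F(x,y)=\sup\{\rho(\beta^{\mathbf{n}}x,\beta^{\mathbf{n}}y):\mathbf{n}\in F\cap\mathbb{Z}^d\}$ (and $0$ if $F\cap\mathbb{Z}^d=\emptyset$), and $F^t=\{\mathbf{x}\in\mathbb{R}^d:\operatorname{dist}(\mathbf{x},F)\le t\}$. $F$ is expansive for $\beta$ if there are $\varepsilon>0$, $t>0$ such that $\rho_\beta^{F^t}(x,y)\le\varepsilon$ implies $x=y$; $\beta$ is expansive if $F=\mathbb{R}^d$ is expansive for $\beta$. $\mathsf{E}_k(\beta)$ is the set of $k$-dimensional linear subspaces ($k$-planes) of $\mathbb{R}^d$ that are expansive for $\beta$. A $k$-plane $V$ is rational if $V\cap\mathbb{Z}^d$ spans $V$. $\mathsf{h}(\beta,V\cap\mathbb{Z}^d)$ denotes the topological entropy of the $\mathbb{Z}^k$-action obtained by restricting $\beta$ to the rank-$k$ group $V\cap\mathbb{Z}^d$. Expansive rank: $\operatorname{exprk}(\beta)=\min\{k:\mathsf{E}_k(\beta)\ne\emptyset\}$, with $\operatorname{exprk}(\beta)=d+1$ if $\beta$ is not expansive. Entropy rank: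 $\operatorname{entrk}(\beta)=\max\{k:\text{there is a rational }k\text{-plane }V\text{ with }\mathsf{h}(\beta,V\cap\mathbb{Z}^d)>0\}$, with $\operatorname{entrk}(\beta)=0$ if this set is empty. *)

theory Defs
  imports "HOL-Analysis.Analysis"
begin

text \<open>
  \<open>\<int>\<^sup>d\<close> is \<open>int ^ 'd\<close> and \<open>\<real>\<^sup>d\<close> is \<open>real ^ 'd\<close>. The compact metric space is a compact
  subset \<open>X\<close> of a metric space type; nothing below depends on the values of \<open>\<beta> n\<close> outside \<open>X\<close>.
\<close>

definition real_vec :: "int ^ 'd \<Rightarrow> real ^ 'd" where
  "real_vec n = (\<chi> i. real_of_int (n $ i))"

definition lattice_points :: "(real ^ 'd::finite) set \<Rightarrow> (int ^ 'd) set" where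
  "lattice_points F = {n. real_vec n \<in> F}"

definition topological_action ::
    "'a::metric_space set \<Rightarrow> (int ^ 'd::finite \<Rightarrow> 'a \<Rightarrow> 'a) \<Rightarrow> bool" where
  "topological_action X \<beta> \<longleftrightarrow>
     (\<forall>n. \<exists>g. homeomorphism X X (\<beta> n) g) \<and>
     (\<forall>m n. \<forall>x\<in>X. \<beta> (m + n) x = \<beta> m (\<beta> n x))"

subsection \<open>Expansive rank\<close>

definition rho ::
    "(int ^ 'd::finite \<Rightarrow> 'a::metric_space \<Rightarrow> 'a) \<Rightarrow> (real ^ 'd) set \<Rightarrow> 'a \<Rightarrow> 'a \<Rightarrow> real" where
  "rho \<beta> F x y =
     (if lattice_points F = {} then 0
      else (SUP n\<in>lattice_points F. dist (\<beta> n x) (\<beta> n y)))"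

text \<open>The guard is needed because \<open>infdist x {} = 0\<close>, whereas the distance to \<open>{}\<close> is infinite.\<close>

definition thicken :: "(real ^ 'd::finite) set \<Rightarrow> real \<Rightarrow> (real ^ 'd) set" where
  "thicken F t = {x. F \<noteq> {} \<and> infdist x F \<le> t}"

definition expansive_set ::
    "'a::metric_space set \<Rightarrow> (int ^ 'd::finite \<Rightarrow> 'a \<Rightarrow> 'a) \<Rightarrow> (real ^ 'd) set \<Rightarrow> bool" where
  "expansive_set X \<beta> F \<longleftrightarrow>
     (\<exists>\<epsilon>>0. \<exists>t>0. \<forall>x\<in>X. \<forall>y\<in>X. rho \<beta> (thicken F t) x y \<le> \<epsilon> \<longrightarrow> x = y)"

definition expansive ::
    "'a::metric_space set \<Rightarrow> (int ^ 'd::finite \<Rightarrow> 'a \<Rightarrow> 'a) \<Rightarrow> bool" where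
  "expansive X \<beta> \<longleftrightarrow> expansive_set X \<beta> UNIV"

definition planes :: "nat \<Rightarrow> (real ^ 'd::finite) set set" where
  "planes k = {V. subspace V \<and> dim V = k}"

definition expansive_planes ::
    "'a::metric_space set \<Rightarrow> (int ^ 'd::finite \<Rightarrow> 'a \<Rightarrow> 'a) \<Rightarrow> nat \<Rightarrow> (real ^ 'd) set set" where
  "expansive_planes X \<beta> k = {V \<in> planes k. expansive_set X \<beta> V}"

definition exprk ::
    "'a::metric_space set \<Rightarrow> (int ^ 'd::finite \<Rightarrow> 'a \<Rightarrow> 'a) \<Rightarrow> nat" where
  "exprk X \<beta> =
     (if expansive X \<beta> then (LEAST k. expansive_planes X \<beta> k \<noteq> {}) else CARD('d) + 1)"

subsection \<open>Topological entropy of restrictions to subgroups of \<open>\<int>\<^sup>d\<close>\<close>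

definition open_covers :: "'a::metric_space set \<Rightarrow> 'a set set set" where
  "open_covers X = {\<U>. (\<forall>A\<in>\<U>. openin (top_of_set X) A) \<and> \<Union>\<U> = X}"

definition subcover_number :: "'a set \<Rightarrow> 'a set set \<Rightarrow> nat" where
  "subcover_number X \<U> = (LEAST m. \<exists>\<V>\<subseteq>\<U>. finite \<V> \<and> card \<V> = m \<and> \<Union>\<V> = X)"

text \<open>The common refinement of the covers \<open>(\<beta> n)\<^sup>-\<^sup>1 \<U>\<close> over \<open>n \<in> Q\<close>.\<close>

definition refined_cover ::
    "'a set \<Rightarrow> (int ^ 'd \<Rightarrow> 'a \<Rightarrow> 'a) \<Rightarrow> (int ^ 'd) set \<Rightarrow> 'a set set \<Rightarrow> 'a set set" where
  "refined_cover X \<beta> Q \<U> = {{x \<in> X. \<forall>n\<in>Q. \<beta> n x \<in> W n} |W. W \<in> Q \<rightarrow> \<U>}"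

definition int_comb :: "(int ^ 'd) list \<Rightarrow> (nat \<Rightarrow> int) \<Rightarrow> int ^ 'd" where
  "int_comb b c = (\<Sum>i<length b. c i *s (b ! i))"

definition int_cube :: "(int ^ 'd) list \<Rightarrow> nat \<Rightarrow> (int ^ 'd) set" where
  "int_cube b n = {int_comb b c |c. \<forall>i<length b. 0 \<le> c i \<and> c i < int n}"

text \<open>
  For \<open>b\<close> linearly independent over \<open>\<int>\<close> and \<open>k = length b\<close>, this is the topological entropy
  (in the sense of Adler, Konheim and McAndrew, with the cubes \<open>{0..<n}\<^sup>k\<close> as averaging sets) of the
  \<open>\<int>\<^sup>k\<close>-action \<open>c \<mapsto> \<beta> (int_comb b c)\<close>. The \<open>limsup\<close> is a limit by subadditivity.
\<close>

definition tuple_entropy ::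
    "'a::metric_space set \<Rightarrow> (int ^ 'd::finite \<Rightarrow> 'a \<Rightarrow> 'a) \<Rightarrow> (int ^ 'd) list \<Rightarrow> ereal" where
  "tuple_entropy X \<beta> b =
     (SUP \<U>\<in>open_covers X.
        limsup (\<lambda>n. ereal (ln (real (subcover_number X (refined_cover X \<beta> (int_cube b n) \<U>)))
                           / real (n ^ length b))))"

definition int_basis :: "(int ^ 'd) list \<Rightarrow> (int ^ 'd) set \<Rightarrow> bool" where
  "int_basis b \<Gamma> \<longleftrightarrow>
     range (int_comb b) = \<Gamma> \<and> (\<forall>c. int_comb b c = 0 \<longrightarrow> (\<forall>i<length b. c i = 0))"

text \<open>
  A subgroup of \<open>\<int>\<^sup>d\<close> of rank \<open>k\<close> has a \<open>\<int>\<close>-basis, which identifies it with \<open>\<int>\<^sup>k\<close>; the entropy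
  of the resulting \<open>\<int>\<^sup>k\<close>-action is the same for every basis.
\<close>

definition subgroup_entropy ::
    "'a::metric_space set \<Rightarrow> (int ^ 'd::finite \<Rightarrow> 'a \<Rightarrow> 'a) \<Rightarrow> (int ^ 'd) set \<Rightarrow> ereal" where
  "subgroup_entropy X \<beta> \<Gamma> = tuple_entropy X \<beta> (SOME b. int_basis b \<Gamma>)"

subsection \<open>Entropy rank\<close>

definition rational_subspace :: "(real ^ 'd::finite) set \<Rightarrow> bool" where
  "rational_subspace V \<longleftrightarrow> span (real_vec ` lattice_points V) = V"

definition entropy_dims ::
    "'a::metric_space set \<Rightarrow> (int ^ 'd::finite \<Rightarrow> 'a \<Rightarrow> 'a) \<Rightarrow> nat set" where
  "entropy_dims X \<beta> =
     {k. \<exists>V\<in>planes k. rational_subspace V \<and> subgroup_entropy X \<beta> (lattice_points V) > 0}"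

definition entrk ::
    "'a::metric_space set \<Rightarrow> (int ^ 'd::finite \<Rightarrow> 'a \<Rightarrow> 'a) \<Rightarrow> nat" where
  "entrk X \<beta> = (if entropy_dims X \<beta> = {} then 0 else Max (entropy_dims X \<beta>))"

end

theory Submission
  imports Defs
begin

text \<open>
  Let \<open>V\<close> be an expansive \<open>k\<close>-plane, with expansive constants \<open>\<epsilon>\<close> and \<open>t\<close>. By compactness, \<open>\<epsilon>\<close>-closeness
  of the orbits of two points along finitely many lattice points \<open>F\<close> of the slab \<open>V\<^sup>t\<close> already forces
  closeness, as fine as desired, along any prescribed finite set
  (\<open>expansive_finite_determination\<close>). As this holds for all translates of \<open>F\<close>, closeness on
  a somewhat wider slab, restricted to a ball of radius \<open>C r\<close>, propagates outwards from \<open>V\<close> at bounded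
  speed until it fills the whole ball of radius \<open>r\<close> (\<open>spread_from_slab\<close>,
  \<open>expansive_plane_determines_balls\<close>).

  That part of the slab has only \<open>O(r\<^sup>k)\<close> lattice points (\<open>card_slab_lattice_ball\<close>), so the orbits
  of all points of \<open>X\<close> over the ball of radius \<open>r\<close> fall into \<open>exp (O(r\<^sup>k))\<close> classes at a given precision
  (\<open>subcover_number_le_itineraries\<close>, \<open>expansive_plane_complexity\<close>). A rational plane of
  dimension \<open>l > k\<close> averages the logarithm of this number over \<open>n\<^sup>l\<close> lattice points of a cube that fits
  into a ball of radius \<open>O(n)\<close>, hence has entropy \<open>0\<close>. So no dimension above
  \<open>k\<close> contributes to the entropy rank. If there is no expansive plane at all, the bound is
  \<open>d + 1\<close>, which exceeds the dimension of every plane.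

  The averaging exponent in the entropy of a subgroup is the length of a chosen integral basis; that
  such a basis exists (\<open>ex_int_basis\<close>) and has at least \<open>l\<close> members (\<open>dim_le_length_int_basis\<close>)
  is the remaining, algebraic ingredient.
\<close>

section \<open>Lattice points\<close>

lemma real_vec_add: "real_vec (m + n) = real_vec m + real_vec n"
  and real_vec_diff: "real_vec (m - n) = real_vec m - real_vec n"
  and real_vec_smult: "real_vec (c *s m) = real_of_int c *\<^sub>R real_vec m"
  and real_vec_0: "real_vec 0 = 0"
  by (simp_all add: real_vec_def vec_eq_iff)

lemma real_vec_sum: "real_vec (\<Sum>i\<in>I. f i) = (\<Sum>i\<in>I. real_vec (f i))"
  by (induction I rule: infinite_finite_induct) (simp_all add: real_vec_0 real_vec_add)

lemma finite_lattice_ball: "finite {n :: int ^ 'd::finite. norm (real_vec n) \<le> r}"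
proof (rule finite_subset)
  let ?N = "\<lceil>r\<rceil>"
  show "{n :: int ^ 'd. norm (real_vec n) \<le> r} \<subseteq> vec_lambda ` (UNIV \<rightarrow>\<^sub>E {-?N..?N})"
  proof clarify
    fix n :: "int ^ 'd" assume n: "norm (real_vec n) \<le> r"
    have "n $ i \<in> {-?N..?N}" for i
    proof -
      have "\<bar>real_of_int (n $ i)\<bar> \<le> r"
        using component_le_norm_cart[of "real_vec n" i] n by (simp add: real_vec_def)
      then show ?thesis by simp linarith
    qed
    then show "n \<in> vec_lambda ` (UNIV \<rightarrow>\<^sub>E {-?N..?N})"
      by (intro image_eqI[where x = "($) n"]) (auto simp: vec_lambda_eta)
  qed
  show "finite (vec_lambda ` ((UNIV::'d set) \<rightarrow>\<^sub>E {-?N..?N}))"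
    by (intro finite_imageI finite_PiE) auto
qed

lemma nearby_lattice_point:
  fixes x :: "real ^ 'd::finite"
  obtains q :: "int ^ 'd" where "norm (x - real_vec q) \<le> real CARD('d)"
proof
  let ?q = "(\<chi> i. \<lfloor>x $ i\<rfloor>) :: int ^ 'd"
  have "norm (x - real_vec ?q) \<le> (\<Sum>i\<in>UNIV. \<bar>(x - real_vec ?q) $ i\<bar>)"
    by (rule norm_le_l1_cart)
  also have "\<dots> \<le> (\<Sum>i\<in>(UNIV::'d set). 1)"
    by (intro sum_mono) (simp add: real_vec_def, linarith)
  finally show "norm (x - real_vec ?q) \<le> real CARD('d)" by simp
qed

lemma thicken_subspace_iff:
  assumes "subspace V"
  shows "x \<in> thicken V t \<longleftrightarrow> (\<exists>v\<in>V. norm (x - v) \<le> t)"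
proof
  have ne: "V \<noteq> {}" using subspace_0[OF assms] by auto
  { assume "x \<in> thicken V t"
    moreover obtain v where "v \<in> V" "infdist x V = dist x v"
      using infdist_attains_inf[OF closed_subspace[OF assms] ne] by blast
    ultimately show "\<exists>v\<in>V. norm (x - v) \<le> t" by (auto simp: thicken_def dist_norm) }
  { assume "\<exists>v\<in>V. norm (x - v) \<le> t"
    then show "x \<in> thicken V t"
      using ne by (auto simp: thicken_def dist_norm intro: order_trans[OF infdist_le]) }
qed

lemma lattice_points_slab_iff:
  assumes "subspace V"
  shows "n \<in> lattice_points (thicken V t) \<longleftrightarrow> (\<exists>v\<in>V. norm (real_vec n - v) \<le> t)"
  by (simp add: lattice_points_def thicken_subspace_iff[OF assms])

text \<open>
  The integer parts of the coordinates along an orthonormal basis of \<open>V\<close> take \<open>(2r + 1)\<^sup>k\<close> values,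
  and they determine a lattice point of the slab up to an error bounded independently of \<open>r\<close>.
\<close>

lemma card_slab_lattice_ball:
  fixes V :: "(real ^ 'd::finite) set"
  assumes V: "subspace V" "dim V = k"
  obtains K :: nat where
    "\<And>r::nat. 1 \<le> r \<Longrightarrow>
       card {n \<in> lattice_points (thicken V s). norm (real_vec n) \<le> real r} \<le> K * r ^ k"
proof -
  obtain B where B: "B \<subseteq> V" "pairwise orthogonal B" "\<And>x. x \<in> B \<Longrightarrow> norm x = 1"
    "independent B" "card B = dim V" "span B = V"
    using orthonormal_basis_subspace[OF V(1)] by metis
  have finB: "finite B" using B(4) by (rule independent_imp_finite)
  define D where "D = {n :: int ^ 'd. norm (real_vec n) \<le> real k + 2 * s}"
  have finD: "finite D" unfolding D_def by (rule finite_lattice_ball)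
  have proj: "norm v \<le> (\<Sum>b\<in>B. \<bar>v \<bullet> b\<bar>)" if "v \<in> V" for v
  proof -
    have "v = (\<Sum>b\<in>B. (v \<bullet> b) *\<^sub>R b)"
      by (subst orthonormal_basis_expand) (use B finB that in auto)
    then have "norm v \<le> (\<Sum>b\<in>B. norm ((v \<bullet> b) *\<^sub>R b))" by (metis norm_sum)
    then show ?thesis using B(3) by simp
  qed
  have "card {n \<in> lattice_points (thicken V s). norm (real_vec n) \<le> real r} \<le> card D * 3 ^ k * r ^ k"
    if r: "1 \<le> r" for r :: nat
  proof -
    define S where "S = {n \<in> lattice_points (thicken V s). norm (real_vec n) \<le> real r}"
    define g where "g n = restrict (\<lambda>b. \<lfloor>real_vec n \<bullet> b\<rfloor>) B" for n :: "int ^ 'd"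
    define rep where "rep y = (SOME n. n \<in> S \<and> g n = y)" for y
    have gS: "g n \<in> B \<rightarrow>\<^sub>E {- int r..int r}" if "n \<in> S" for n
    proof -
      have "\<lfloor>real_vec n \<bullet> b\<rfloor> \<in> {- int r..int r}" if "b \<in> B" for b
      proof -
        have "\<bar>real_vec n \<bullet> b\<bar> \<le> norm (real_vec n) * norm b" by (rule Cauchy_Schwarz_ineq2)
        also have "\<dots> \<le> real r" using B(3)[OF that] \<open>n \<in> S\<close> by (simp add: S_def)
        finally show ?thesis by (simp add: abs_le_iff) linarith
      qed
      then show ?thesis by (auto simp: g_def)
    qed
    have rep: "rep (g n) \<in> S \<and> g (rep (g n)) = g n" if "n \<in> S" for n
      unfolding rep_def by (rule someI[of _ n]) (use that in simp)
    have diff: "n - m \<in> D" if nm: "n \<in> S" "m \<in> S" "g m = g n" for n m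
    proof -
      have *: "\<exists>v\<in>V. norm (real_vec n - v) \<le> s \<and> (\<forall>b\<in>B. v \<bullet> b = real_vec n \<bullet> b)"
        if n: "n \<in> S" for n
      proof -
        obtain u where u: "u \<in> V" "norm (real_vec n - u) \<le> s"
          using n by (auto simp: S_def lattice_points_slab_iff[OF V(1)])
        obtain y z where yz: "y \<in> span V" "\<And>w. w \<in> span V \<Longrightarrow> orthogonal z w" "real_vec n = y + z"
          using orthogonal_subspace_decomp_exists[of V "real_vec n"] by metis
        \<comment> \<open>The orthogonal projection \<open>y\<close> is at least as close to the lattice point as \<open>u\<close> is, and it
          has the same coordinates along \<open>B\<close> as the lattice point itself.\<close>
        have sp: "span V = V" using V(1) by (simp add: span_eq_iff)
        have "orthogonal (y - u) z"
          using yz(2)[of "y - u"] yz(1) u(1) V(1) by (simp add: sp subspace_diff orthogonal_commute)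
        then have "norm (y - u + z) ^ 2 = norm (y - u) ^ 2 + norm z ^ 2"
          by (rule norm_add_Pythagorean)
        then have "norm z ^ 2 \<le> norm (real_vec n - u) ^ 2" by (simp add: yz(3) algebra_simps)
        then have "norm z \<le> norm (real_vec n - u)" by (rule power2_le_imp_le) simp
        moreover have "z \<bullet> b = 0" if "b \<in> B" for b
          using yz(2)[of b] B(1) that by (auto simp: sp orthogonal_def)
        ultimately show ?thesis
          using yz(1,3) u(2) by (intro bexI[of _ y]) (auto simp: sp inner_add_left)
      qed
      obtain v where v: "v \<in> V" "norm (real_vec n - v) \<le> s" "\<forall>b\<in>B. v \<bullet> b = real_vec n \<bullet> b"
        using *[OF nm(1)] by blast
      obtain w where w: "w \<in> V" "norm (real_vec m - w) \<le> s" "\<forall>b\<in>B. w \<bullet> b = real_vec m \<bullet> b"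
        using *[OF nm(2)] by blast
      have "norm (v - w) \<le> (\<Sum>b\<in>B. \<bar>(v - w) \<bullet> b\<bar>)"
        by (rule proj) (use v w V(1) in \<open>simp add: subspace_diff\<close>)
      also have "\<dots> \<le> (\<Sum>b\<in>B. 1)"
      proof (rule sum_mono)
        fix b assume b: "b \<in> B"
        have "\<lfloor>real_vec m \<bullet> b\<rfloor> = \<lfloor>real_vec n \<bullet> b\<rfloor>"
          using fun_cong[OF nm(3), of b] b by (simp add: g_def)
        then show "\<bar>(v - w) \<bullet> b\<bar> \<le> 1" using v(3) w(3) b by (simp add: inner_diff_left) linarith
      qed
      finally have "norm (v - w) \<le> k" using B(5) V(2) by simp
      moreover have "real_vec (n - m) = (real_vec n - v) - (real_vec m - w) + (v - w)"
        by (simp add: real_vec_diff)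
      ultimately show ?thesis using v(2) w(2) unfolding D_def
        by (smt (verit) mem_Collect_eq norm_triangle_ineq norm_triangle_ineq4)
    qed
    \<comment> \<open>A point is encoded by its class under \<open>g\<close> and its difference to a representative.\<close>
    have "card S \<le> card ((B \<rightarrow>\<^sub>E {- int r..int r}) \<times> D)"
    proof (rule card_inj_on_le)
      show "inj_on (\<lambda>n. (g n, n - rep (g n))) S" by (rule inj_onI) auto
      show "(\<lambda>n. (g n, n - rep (g n))) ` S \<subseteq> (B \<rightarrow>\<^sub>E {- int r..int r}) \<times> D"
        using gS diff rep by blast
      show "finite ((B \<rightarrow>\<^sub>E {- int r..int r}) \<times> D)" using finB finD by (simp add: finite_PiE)
    qed
    also have "\<dots> = (2 * r + 1) ^ k * card D"
      using finB B(5) V(2) by (simp add: card_cartesian_product card_PiE nat_add_distrib nat_mult_distrib)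
    also have "\<dots> \<le> (3 * r) ^ k * card D"
      by (intro mult_right_mono power_mono) (use r in auto)
    finally show ?thesis unfolding S_def by (simp add: power_mult_distrib mult_ac)
  qed
  then show ?thesis using that by blast
qed

section \<open>Closeness on a slab spreads to balls\<close>

text \<open>
  A lattice point \<open>m\<close> in the slab of half-width \<open>s + j + 1\<close> but not in that of half-width \<open>s + j\<close> is
  \<open>p + q\<close>, where \<open>p\<close> lies \<open>s\<close> nearer to \<open>V\<close>, up to the rounding error of a lattice point, and \<open>q\<close> is bounded
  independently of \<open>m\<close>. The value of \<open>s\<close> is chosen so that the translate of \<open>F\<close> by \<open>p\<close> then lies in
  the slab of half-width \<open>s + j\<close>. Each step widens the slab by \<open>1\<close> and costs a fixed amount of radius.
\<close>

lemma spread_from_slab: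
  fixes V :: "(real ^ 'd::finite) set" and F A :: "(int ^ 'd) set"
  assumes V: "subspace V" and t: "0 \<le> t"
    and F: "F \<subseteq> lattice_points (thicken V t)" "\<And>e. e \<in> F \<Longrightarrow> norm (real_vec e) \<le> R"
    and local: "\<And>p q. (\<And>e. e \<in> F \<Longrightarrow> e + p \<in> A) \<Longrightarrow>
        norm (real_vec q) \<le> t + 1 + 2 * real CARD('d) \<Longrightarrow> q + p \<in> A"
    and s: "s = t + 1 + real CARD('d)"
    and R': "R + t + 1 + 2 * real CARD('d) \<le> R'" and R0: "0 \<le> R'"
    and start: "{n \<in> lattice_points (thicken V s). norm (real_vec n) \<le> r} \<subseteq> A"
  shows "{n \<in> lattice_points (thicken V (s + real j)). norm (real_vec n) \<le> r - real j * R'} \<subseteq> A"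
proof (induction j)
  case 0
  then show ?case using start by simp
next
  case (Suc j)
  let ?D = "real CARD('d)"
  show ?case
  proof clarify
    fix m assume "m \<in> lattice_points (thicken V (s + real (Suc j)))"
      and nm: "norm (real_vec m) \<le> r - real (Suc j) * R'"
    then obtain v where v: "v \<in> V" "norm (real_vec m - v) \<le> s + j + 1"
      by (auto simp: lattice_points_slab_iff[OF V])
    define w where "w = real_vec m - v"
    have nm': "norm (real_vec m) + R' \<le> r - real j * R'" using nm by (simp add: algebra_simps)
    show "m \<in> A"
    proof (cases "norm w \<le> s + j")
      case True
      then have "m \<in> lattice_points (thicken V (s + real j))"
        using v(1) by (auto simp: lattice_points_slab_iff[OF V] w_def)
      moreover have "norm (real_vec m) \<le> r - real j * R'" using nm' R0 by linarith
      ultimately show ?thesis using Suc.IH by blast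
    next
      case False
      then have w0: "norm w > 0" "s \<le> norm w" using s t by auto
      \<comment> \<open>\<open>u\<close> is the displacement of length \<open>s\<close> pointing away from \<open>V\<close>, and \<open>q\<close> its rounding.\<close>
      define u where "u = (s / norm w) *\<^sub>R w"
      have nu: "norm u = s" using w0 s t by (simp add: u_def)
      have "w - u = (1 - s / norm w) *\<^sub>R w" by (simp add: u_def scaleR_diff_left)
      then have "norm (w - u) = \<bar>1 - s / norm w\<bar> * norm w" by simp
      also have "\<dots> = norm w - s" using w0 by (simp add: field_simps)
      finally have wu: "norm (w - u) \<le> j + 1" using v(2) by (simp add: w_def)
      obtain q :: "int ^ 'd" where q: "norm (u - real_vec q) \<le> ?D" by (rule nearby_lattice_point)
      have nq: "norm (real_vec q) \<le> t + 1 + 2 * ?D"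
        using norm_triangle_sub[of "real_vec q" u] q nu s by (simp add: norm_minus_commute)
      define p where "p = m - q"
      have "q + p \<in> A"
      proof (rule local[OF _ nq])
        fix e assume e: "e \<in> F"
        obtain y where y: "y \<in> V" "norm (real_vec e - y) \<le> t"
          using subsetD[OF F(1) e] by (auto simp: lattice_points_slab_iff[OF V])
        have eq: "real_vec (e + p) - (y + v) = (real_vec e - y) + ((w - u) + (u - real_vec q))"
          by (simp add: p_def real_vec_add real_vec_diff w_def)
        have "norm (real_vec (e + p) - (y + v)) \<le> t + ((j + 1) + ?D)"
          unfolding eq using y(2) wu q by (intro norm_triangle_mono) auto
        then have "e + p \<in> lattice_points (thicken V (s + real j))"
          using y(1) v(1) V s
          by (auto simp: lattice_points_slab_iff[OF V] algebra_simps intro!: bexI[of _ "y + v"] subspace_add)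
        moreover have "norm (real_vec (e + p)) \<le> R + (norm (real_vec m) + (t + 1 + 2 * ?D))"
          unfolding p_def real_vec_add real_vec_diff
          using F(2)[OF e] nq
          by (intro norm_triangle_mono order_trans[OF norm_triangle_ineq4]) auto
        ultimately show "e + p \<in> A" using Suc.IH nm' R' by auto
      qed
      then show ?thesis by (simp add: p_def)
    qed
  qed
qed

section \<open>Expansive sets of lattice points\<close>

lemma action_continuous_on:
  assumes "topological_action X \<beta>"
  shows "continuous_on X (\<beta> n)" and "x \<in> X \<Longrightarrow> \<beta> n x \<in> X"
proof -
  obtain g where "homeomorphism X X (\<beta> n) g" using assms unfolding topological_action_def by blast
  then show "continuous_on X (\<beta> n)" and "x \<in> X \<Longrightarrow> \<beta> n x \<in> X" by (auto simp: homeomorphism_def)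
qed

text \<open>
  Otherwise, by compactness of \<open>X \<times> X\<close>, some pair would be \<open>\<epsilon>\<close>-close on all of \<open>E\<close> and yet distinct.
\<close>

lemma expansive_finite_determination:
  fixes X :: "'a::metric_space set" and \<beta> :: "int ^ 'd::finite \<Rightarrow> 'a \<Rightarrow> 'a"
  assumes X: "compact X" and act: "topological_action X \<beta>"
    and E: "\<forall>x\<in>X. \<forall>y\<in>X. (\<forall>n\<in>E. dist (\<beta> n x) (\<beta> n y) \<le> \<epsilon>) \<longrightarrow> x = y"
    and Q: "finite Q" and \<delta>: "0 < \<delta>"
  shows "\<exists>F\<subseteq>E. finite F \<and> (\<forall>x\<in>X. \<forall>y\<in>X. (\<forall>n\<in>F. dist (\<beta> n x) (\<beta> n y) \<le> \<epsilon>) \<longrightarrow>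
       (\<forall>q\<in>Q. dist (\<beta> q x) (\<beta> q y) < \<delta>))"
proof -
  define D where "D n z = dist (\<beta> n (fst z)) (\<beta> n (snd z))" for n z
  define C where "C n = {z \<in> X \<times> X. D n z \<le> \<epsilon>}" for n
  define K where "K = (\<Union>q\<in>Q. {z \<in> X \<times> X. \<delta> \<le> D q z})"
  have XX: "compact (X \<times> X)" using X X by (rule compact_Times)
  have D: "continuous_on (X \<times> X) (D n)" for n
    unfolding D_def
    by (intro continuous_on_dist continuous_on_compose2[OF action_continuous_on(1)[OF act]]
        continuous_intros) auto
  have closed: "closed {z \<in> X \<times> X. \<delta> \<le> D q z}" for q
    using continuous_closed_preimage[OF D[of q] compact_imp_closed[OF XX] closed_atLeast[of \<delta>]]
    by (simp add: vimage_def Int_def)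
  have K: "compact K"
    unfolding K_def
  proof (rule compact_UN[OF Q])
    fix q assume "q \<in> Q"
    show "compact {z \<in> X \<times> X. \<delta> \<le> D q z}"
      using compact_Int_closed[OF XX closed[of q]] by (simp add: Int_def cong: conj_cong)
  qed
  have clC: "closed (C n)" for n
    unfolding C_def
    using continuous_closed_preimage[OF D[of n] compact_imp_closed[OF XX] closed_atMost[of \<epsilon>]]
    by (simp add: vimage_def Int_def)
  have "K \<inter> (\<Inter>n\<in>E. C n) = {}"
  proof (rule ccontr)
    assume "K \<inter> (\<Inter>n\<in>E. C n) \<noteq> {}"
    then obtain z q where z: "z \<in> X \<times> X" "\<delta> \<le> D q z" "\<And>n. n \<in> E \<Longrightarrow> z \<in> C n"
      by (auto simp: K_def)
    then have "fst z = snd z" by (intro E[rule_format]) (auto simp: C_def D_def)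
    then show False using z(2) \<delta> by (simp add: D_def)
  qed
  then obtain F where F: "finite F" "F \<subseteq> E" "K \<inter> (\<Inter>n\<in>F. C n) = {}"
    using compact_imp_fip_image[OF K, of E C] clC by meson
  show ?thesis
  proof (intro exI[of _ F] conjI F ballI impI)
    fix x y q
    assume xy: "x \<in> X" "y \<in> X" and cl: "\<forall>n\<in>F. dist (\<beta> n x) (\<beta> n y) \<le> \<epsilon>" and q: "q \<in> Q"
    have "(x, y) \<in> (\<Inter>n\<in>F. C n)" using xy cl by (auto simp: C_def D_def)
    then have "(x, y) \<notin> K" using F(3) by blast
    then show "dist (\<beta> q x) (\<beta> q y) < \<delta>" using xy q by (auto simp: K_def D_def not_le)
  qed
qed

text \<open>
  The finite sets that determine closeness near a point serve at every lattice point by translation: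
  one of them drives the spreading from the slab, another turns \<open>\<epsilon>\<close>-closeness on a slightly larger
  ball into \<open>\<delta>\<close>-closeness.
\<close>

lemma expansive_plane_determines_balls:
  fixes X :: "'a::metric_space set" and \<beta> :: "int ^ 'd::finite \<Rightarrow> 'a \<Rightarrow> 'a"
  assumes X: "compact X" and act: "topological_action X \<beta>"
    and V: "subspace V" "expansive_set X \<beta> V"
  shows "\<exists>\<epsilon>>0. \<exists>s. \<forall>\<delta>>0. \<forall>a. \<exists>L::nat. \<forall>n\<ge>1. \<forall>x\<in>X. \<forall>y\<in>X.
       (\<forall>m \<in> lattice_points (thicken V s). norm (real_vec m) \<le> real (L * n) \<longrightarrow> dist (\<beta> m x) (\<beta> m y) \<le> \<epsilon>) \<longrightarrow>
       (\<forall>m. norm (real_vec m) \<le> real (a * n) \<longrightarrow> dist (\<beta> m x) (\<beta> m y) < \<delta>)"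
proof -
  let ?D = "real CARD('d)"
  obtain \<epsilon> t where \<epsilon>: "0 < \<epsilon>" and t: "0 < t"
    and ex: "\<And>x y. x \<in> X \<Longrightarrow> y \<in> X \<Longrightarrow> rho \<beta> (thicken V t) x y \<le> \<epsilon> \<Longrightarrow> x = y"
    using V(2) unfolding expansive_set_def by blast
  define E where "E = lattice_points (thicken V t)"
  have E: "\<forall>x\<in>X. \<forall>y\<in>X. (\<forall>n\<in>E. dist (\<beta> n x) (\<beta> n y) \<le> \<epsilon>) \<longrightarrow> x = y"
  proof (intro ballI impI)
    fix x y
    assume "x \<in> X" "y \<in> X" "\<forall>n\<in>E. dist (\<beta> n x) (\<beta> n y) \<le> \<epsilon>"
    then show "x = y"
      by (intro ex) (use \<epsilon> in \<open>auto simp: rho_def E_def intro!: cSUP_least\<close>)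
  qed
  have bounded: "\<exists>R::nat. \<forall>e\<in>F. norm (real_vec e) \<le> real R" if "finite F" for F :: "(int ^ 'd) set"
  proof -
    have "\<exists>R::nat. (\<Sum>e\<in>F. norm (real_vec e)) \<le> real R" by (rule real_arch_simple)
    then show ?thesis using member_le_sum[of _ F "\<lambda>e. norm (real_vec e)"] that
      by (meson norm_ge_zero order_trans)
  qed
  have mult: "\<beta> (m + n) x = \<beta> m (\<beta> n x)" if "x \<in> X" for m n x
    using act that by (simp add: topological_action_def)
  have finite_singleton0: "finite {0 :: int ^ 'd}" by simp
  obtain F1 where F1: "finite F1" "F1 \<subseteq> E"
    "\<forall>x\<in>X. \<forall>y\<in>X. (\<forall>n\<in>F1. dist (\<beta> n x) (\<beta> n y) \<le> \<epsilon>) \<longrightarrow>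
       (\<forall>q\<in>{q. norm (real_vec q) \<le> t + 1 + 2 * ?D}. dist (\<beta> q x) (\<beta> q y) < \<epsilon>)"
    using expansive_finite_determination[OF X act E finite_lattice_ball[of "t + 1 + 2 * ?D"] \<epsilon>]
    by (elim exE conjE)
  obtain R1 :: nat where R1: "\<forall>e\<in>F1. norm (real_vec e) \<le> real R1" using bounded[OF F1(1)] by blast
  obtain R' :: nat where R': "real R1 + t + 1 + 2 * ?D \<le> real R'" using real_arch_simple by blast
  define s where "s = t + 1 + ?D"
  have "\<exists>L::nat. \<forall>n\<ge>1. \<forall>x\<in>X. \<forall>y\<in>X.
       (\<forall>m \<in> lattice_points (thicken V s). norm (real_vec m) \<le> real (L * n) \<longrightarrow> dist (\<beta> m x) (\<beta> m y) \<le> \<epsilon>) \<longrightarrow>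
       (\<forall>m. norm (real_vec m) \<le> real (a * n) \<longrightarrow> dist (\<beta> m x) (\<beta> m y) < \<delta>)"
    if \<delta>: "0 < \<delta>" for \<delta> and a :: nat
  proof -
    obtain F2 where F2: "finite F2" "F2 \<subseteq> E"
      "\<forall>x\<in>X. \<forall>y\<in>X. (\<forall>n\<in>F2. dist (\<beta> n x) (\<beta> n y) \<le> \<epsilon>) \<longrightarrow>
         (\<forall>q\<in>{0}. dist (\<beta> q x) (\<beta> q y) < \<delta>)"
      using expansive_finite_determination[OF X act E finite_singleton0 \<delta>] by (elim exE conjE)
    obtain R2 :: nat where R2: "\<forall>e\<in>F2. norm (real_vec e) \<le> real R2" using bounded[OF F2(1)] by blast
    define L where "L = (a + R2) * (R' + 1)"
    show ?thesis
    proof (intro exI[of _ L] allI impI ballI)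
      fix n x y and m :: "int ^ 'd"
      assume n: "1 \<le> n" and xy: "x \<in> X" "y \<in> X"
        and cl: "\<forall>m \<in> lattice_points (thicken V s). norm (real_vec m) \<le> real (L * n) \<longrightarrow> dist (\<beta> m x) (\<beta> m y) \<le> \<epsilon>"
        and m: "norm (real_vec m) \<le> real (a * n)"
      define A where "A = {m. dist (\<beta> m x) (\<beta> m y) \<le> \<epsilon>}"
      \<comment> \<open>The ball of radius \<open>J\<close> contains the translates of \<open>F2\<close> by all points of norm at most
        \<open>a * n\<close>; the slab contains that ball after \<open>J\<close> widenings.\<close>
      define J where "J = a * n + R2"
      have "{m \<in> lattice_points (thicken V (s + real J)). norm (real_vec m) \<le> real (L * n) - real J * real R'} \<subseteq> A"
      proof (rule spread_from_slab[OF V(1) _ _ _ _ s_def R'])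
        show "0 \<le> t" using t by simp
        show "F1 \<subseteq> lattice_points (thicken V t)" using F1(2) by (simp add: E_def)
        show "norm (real_vec e) \<le> real R1" if "e \<in> F1" for e using R1 that by blast
        show "{m \<in> lattice_points (thicken V s). norm (real_vec m) \<le> real (L * n)} \<subseteq> A"
          using cl by (auto simp: A_def)
        fix p q :: "int ^ 'd" assume p: "\<And>e. e \<in> F1 \<Longrightarrow> e + p \<in> A" and q: "norm (real_vec q) \<le> t + 1 + 2 * ?D"
        have "dist (\<beta> q (\<beta> p x)) (\<beta> q (\<beta> p y)) < \<epsilon>"
          by (rule F1(3)[rule_format])
            (use xy p q action_continuous_on(2)[OF act] in \<open>auto simp: A_def mult\<close>)
        then show "q + p \<in> A" using xy by (simp add: A_def mult)
      qed simp
      moreover have "real J \<le> real (L * n) - real J * real R'"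
      proof -
        have "J \<le> (a + R2) * n" using n by (simp add: J_def algebra_simps)
        then have "J * (R' + 1) \<le> L * n"
          using mult_right_mono[of J "(a + R2) * n" "R' + 1"] by (simp add: L_def mult_ac)
        then have "real J * (real R' + 1) \<le> real (L * n)" by (metis of_nat_1 of_nat_add of_nat_le_iff of_nat_mult)
        then show ?thesis by (simp add: algebra_simps)
      qed
      moreover have "i \<in> lattice_points (thicken V (s + real J))" if "norm (real_vec i) \<le> real J" for i
        using that t subspace_0[OF V(1)]
        by (auto simp: lattice_points_slab_iff[OF V(1)] s_def intro!: bexI[of _ 0])
      ultimately have ball: "i \<in> A" if "norm (real_vec i) \<le> real J" for i
        using that by fastforce
      have "dist (\<beta> 0 (\<beta> m x)) (\<beta> 0 (\<beta> m y)) < \<delta>"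
      proof (rule F2(3)[rule_format])
        fix e assume e: "e \<in> F2"
        have "norm (real_vec (e + m)) \<le> real R2 + real (a * n)"
          unfolding real_vec_add using R2 e m by (intro norm_triangle_mono) auto
        then have "e + m \<in> A" by (intro ball) (simp add: J_def)
        then show "dist (\<beta> e (\<beta> m x)) (\<beta> e (\<beta> m y)) \<le> \<epsilon>" using xy by (simp add: A_def mult)
      qed (use xy action_continuous_on(2)[OF act] in auto)
      then show "dist (\<beta> m x) (\<beta> m y) < \<delta>" using xy mult[of _ 0 m] by simp
    qed
  qed
  then show ?thesis
    by (intro exI[of _ \<epsilon>] exI[of _ s] conjI \<epsilon> allI impI) assumption
qed

section \<open>Entropy\<close>

text \<open>
  Points with the same itinerary through the cells of \<open>P\<close> along \<open>F\<close> stay \<open>\<delta>\<close>-close along \<open>Q\<close>, hence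
  lie in a common element of the refined cover as soon as \<open>\<delta>\<close> is a Lebesgue number of \<open>\<U>\<close>.
\<close>

lemma subcover_number_le_itineraries:
  fixes X :: "'a::metric_space set"
  assumes inv: "\<And>n x. x \<in> X \<Longrightarrow> \<beta> n x \<in> X"
    and P: "finite P" "X \<subseteq> \<Union>P" "\<And>c u v. c \<in> P \<Longrightarrow> u \<in> c \<Longrightarrow> v \<in> c \<Longrightarrow> dist u v \<le> \<epsilon>"
    and F: "finite F"
    and det: "\<And>x y. x \<in> X \<Longrightarrow> y \<in> X \<Longrightarrow> (\<And>n. n \<in> F \<Longrightarrow> dist (\<beta> n x) (\<beta> n y) \<le> \<epsilon>) \<Longrightarrow>
       (\<And>n. n \<in> Q \<Longrightarrow> dist (\<beta> n x) (\<beta> n y) < \<delta>)"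
    and leb: "\<And>x. x \<in> X \<Longrightarrow> \<exists>U\<in>\<U>. X \<inter> ball x \<delta> \<subseteq> U"
  shows "subcover_number X (refined_cover X \<beta> Q \<U>) \<le> card P ^ card F"
proof -
  define cell where "cell u = (SOME c. c \<in> P \<and> u \<in> c)" for u
  have cell: "cell u \<in> P \<and> u \<in> cell u" if "u \<in> X" for u
    unfolding cell_def by (rule someI_ex) (use P(2) that in blast)
  define W where "W u = (SOME U. U \<in> \<U> \<and> X \<inter> ball u \<delta> \<subseteq> U)" for u
  have W: "W u \<in> \<U> \<and> X \<inter> ball u \<delta> \<subseteq> W u" if "u \<in> X" for u
    unfolding W_def by (rule someI_ex) (use leb[OF that] in blast)
  define itin where "itin x = restrict (\<lambda>n. cell (\<beta> n x)) F" for x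
  define rep where "rep w = (SOME x. x \<in> X \<and> itin x = w)" for w
  have rep: "rep (itin x) \<in> X \<and> itin (rep (itin x)) = itin x" if "x \<in> X" for x
    unfolding rep_def by (rule someI[of _ x]) (use that in simp)
  define G where "G w = {y \<in> X. \<forall>n\<in>Q. \<beta> n y \<in> W (\<beta> n (rep w))}" for w
  have fin: "finite (F \<rightarrow>\<^sub>E P)" using F P(1) by (simp add: finite_PiE)
  have sub: "itin ` X \<subseteq> F \<rightarrow>\<^sub>E P" using cell inv by (auto simp: itin_def)
  have finI: "finite (itin ` X)" using sub fin by (rule finite_subset)
  have "x \<in> G (itin x)" if x: "x \<in> X" for x
  proof -
    let ?y = "rep (itin x)"
    have y: "?y \<in> X" "itin ?y = itin x" using rep[OF x] by auto
    have "dist (\<beta> n ?y) (\<beta> n x) \<le> \<epsilon>" if "n \<in> F" for n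
    proof -
      have "cell (\<beta> n ?y) = cell (\<beta> n x)" using fun_cong[OF y(2), of n] that by (simp add: itin_def)
      then show ?thesis
        using P(3)[of "cell (\<beta> n x)"] cell[OF inv[OF x, of n]] cell[OF inv[OF y(1), of n]] by simp
    qed
    then have "dist (\<beta> n ?y) (\<beta> n x) < \<delta>" if "n \<in> Q" for n using det[OF y(1) x] that by blast
    then have "\<beta> n x \<in> W (\<beta> n ?y)" if "n \<in> Q" for n
      using W[OF inv[OF y(1), of n]] inv[OF x, of n] that by (meson IntI mem_ball subsetD)
    then show ?thesis using x by (simp add: G_def)
  qed
  then have "\<Union>(G ` itin ` X) = X" by (auto simp: G_def)
  moreover have "G ` itin ` X \<subseteq> refined_cover X \<beta> Q \<U>"
  proof clarify
    fix x assume "x \<in> X"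
    then have "(\<lambda>n. W (\<beta> n (rep (itin x)))) \<in> Q \<rightarrow> \<U>"
      using W[OF inv] rep[of x] by simp
    then show "G (itin x) \<in> refined_cover X \<beta> Q \<U>"
      unfolding refined_cover_def G_def by (intro CollectI exI[of _ "\<lambda>n. W (\<beta> n (rep (itin x)))"] conjI refl)
  qed
  ultimately have "subcover_number X (refined_cover X \<beta> Q \<U>) \<le> card (G ` itin ` X)"
    unfolding subcover_number_def using finI by (intro Least_le exI[of _ "G ` itin ` X"]) simp
  also have "\<dots> \<le> card (itin ` X)" using finI by (rule card_image_le)
  also have "\<dots> \<le> card (F \<rightarrow>\<^sub>E P)" using fin sub by (rule card_mono)
  also have "\<dots> = card P ^ card F" using F by (simp add: card_PiE)
  finally show ?thesis .
qed

lemma open_cover_lebesgue_number: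
  assumes "compact X" "\<U> \<in> open_covers X"
  obtains \<delta> where "0 < \<delta>" "\<And>x. x \<in> X \<Longrightarrow> \<exists>U\<in>\<U>. X \<inter> ball x \<delta> \<subseteq> U"
proof -
  have cov: "X \<subseteq> \<Union>{T. open T \<and> X \<inter> T \<in> \<U>}"
  proof
    fix x assume "x \<in> X"
    then obtain U where U: "x \<in> U" "U \<in> \<U>" "openin (top_of_set X) U"
      using assms(2) by (auto simp: open_covers_def)
    then obtain T where "open T" "U = X \<inter> T" by (auto simp: openin_open)
    then show "x \<in> \<Union>{T. open T \<and> X \<inter> T \<in> \<U>}" using U by auto
  qed
  obtain e where e: "0 < e" "\<forall>x\<in>X. \<exists>T\<in>{T. open T \<and> X \<inter> T \<in> \<U>}. ball x e \<subseteq> T"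
    by (rule Heine_Borel_lemma[OF assms(1) cov]) auto
  show ?thesis
  proof (rule that[OF e(1)])
    fix x assume "x \<in> X"
    then obtain T where "X \<inter> T \<in> \<U>" "ball x e \<subseteq> T" using e(2) by blast
    then show "\<exists>U\<in>\<U>. X \<inter> ball x e \<subseteq> U" by (intro bexI[of _ "X \<inter> T"]) auto
  qed
qed

lemma finite_cover_small_cells:
  fixes X :: "'a::metric_space set"
  assumes "compact X" "0 < \<epsilon>"
  obtains P where "finite P" "X \<subseteq> \<Union>P" "\<And>c u v. c \<in> P \<Longrightarrow> u \<in> c \<Longrightarrow> v \<in> c \<Longrightarrow> dist u v \<le> \<epsilon>"
proof -
  have "0 < \<epsilon> / 2" using assms(2) by simp
  moreover have "\<forall>e>0. \<exists>k. finite k \<and> X \<subseteq> (\<Union>x\<in>k. ball x e)"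
    using assms(1) unfolding compact_eq_totally_bounded by (rule conjunct2)
  ultimately obtain k where k: "finite k" "X \<subseteq> (\<Union>x\<in>k. ball x (\<epsilon> / 2))" by meson
  show ?thesis
  proof (rule that)
    show "finite ((\<lambda>x. ball x (\<epsilon> / 2)) ` k)" "X \<subseteq> \<Union>((\<lambda>x. ball x (\<epsilon> / 2)) ` k)" using k by auto
    fix c u v assume "c \<in> (\<lambda>x. ball x (\<epsilon> / 2)) ` k" "u \<in> c" "v \<in> c"
    then obtain x where "dist x u < \<epsilon> / 2" "dist x v < \<epsilon> / 2" by auto
    then show "dist u v \<le> \<epsilon>" using dist_triangle_half_r[of x u \<epsilon> v] by simp
  qed
qed

text \<open>
  This is the exponent comparison behind the whole result: along sets of diameter \<open>O(n)\<close>, of whatever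
  dimension, the logarithmic complexity grows at most like the number of lattice points in
  the part of a slab around a \<open>k\<close>-plane within radius \<open>O(n)\<close>.
\<close>

lemma expansive_plane_complexity:
  fixes X :: "'a::metric_space set" and \<beta> :: "int ^ 'd::finite \<Rightarrow> 'a \<Rightarrow> 'a"
  assumes X: "compact X" and act: "topological_action X \<beta>"
    and V: "V \<in> expansive_planes X \<beta> k" and U: "\<U> \<in> open_covers X"
  obtains C :: real where "0 \<le> C"
    "\<And>n Q. 1 \<le> n \<Longrightarrow> (\<And>m. m \<in> Q \<Longrightarrow> norm (real_vec m) \<le> real (a * n)) \<Longrightarrow>
       ln (real (subcover_number X (refined_cover X \<beta> Q \<U>))) \<le> C * real n ^ k"
proof -
  have V: "subspace V" "dim V = k" "expansive_set X \<beta> V"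
    using V by (auto simp: expansive_planes_def planes_def)
  obtain \<epsilon> s :: real where \<epsilon>: "0 < \<epsilon>" and det:
    "\<forall>\<delta>>0. \<forall>a. \<exists>L::nat. \<forall>n\<ge>1. \<forall>x\<in>X. \<forall>y\<in>X.
       (\<forall>m \<in> lattice_points (thicken V s). norm (real_vec m) \<le> real (L * n) \<longrightarrow> dist (\<beta> m x) (\<beta> m y) \<le> \<epsilon>) \<longrightarrow>
       (\<forall>m. norm (real_vec m) \<le> real (a * n) \<longrightarrow> dist (\<beta> m x) (\<beta> m y) < \<delta>)"
    using expansive_plane_determines_balls[OF X act V(1,3)] by (elim exE conjE)
  obtain \<delta> where \<delta>: "0 < \<delta>" "\<And>x. x \<in> X \<Longrightarrow> \<exists>U\<in>\<U>. X \<inter> ball x \<delta> \<subseteq> U"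
    using open_cover_lebesgue_number[OF X U] by blast
  obtain P where P: "finite P" "X \<subseteq> \<Union>P" "\<And>c u v. c \<in> P \<Longrightarrow> u \<in> c \<Longrightarrow> v \<in> c \<Longrightarrow> dist u v \<le> \<epsilon>"
    using finite_cover_small_cells[OF X \<epsilon>] by blast
  obtain L :: nat where L: "\<forall>n\<ge>1. \<forall>x\<in>X. \<forall>y\<in>X.
       (\<forall>m \<in> lattice_points (thicken V s). norm (real_vec m) \<le> real (L * n) \<longrightarrow> dist (\<beta> m x) (\<beta> m y) \<le> \<epsilon>) \<longrightarrow>
       (\<forall>m. norm (real_vec m) \<le> real (a * n) \<longrightarrow> dist (\<beta> m x) (\<beta> m y) < \<delta>)"
    using det[rule_format, OF \<delta>(1), of a] by (elim exE)
  obtain K :: nat where K: "\<And>r::nat. 1 \<le> r \<Longrightarrow>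
       card {n \<in> lattice_points (thicken V s). norm (real_vec n) \<le> real r} \<le> K * r ^ k"
    using card_slab_lattice_ball[OF V(1,2)] by blast
  \<comment> \<open>The maximum makes the powers of \<open>p\<close> increasing even when \<open>P\<close> is empty.\<close>
  define p where "p = max 1 (real (card P))"
  define C where "C = real (K * (L + 1) ^ k) * ln p"
  have C0: "0 \<le> C" by (simp add: C_def p_def)
  have "ln (real (subcover_number X (refined_cover X \<beta> Q \<U>))) \<le> C * real n ^ k"
    if n: "1 \<le> n" and Q: "\<And>m. m \<in> Q \<Longrightarrow> norm (real_vec m) \<le> real (a * n)" for n Q
  proof -
    \<comment> \<open>\<open>L + 1\<close> instead of \<open>L\<close> makes the radius at least \<open>1\<close>, as the lattice point count requires.\<close>
    define F where "F = {m \<in> lattice_points (thicken V s). norm (real_vec m) \<le> real ((L + 1) * n)}"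
    have finF: "finite F"
      unfolding F_def by (rule finite_subset[OF _ finite_lattice_ball[of "real ((L + 1) * n)"]]) blast
    let ?N = "subcover_number X (refined_cover X \<beta> Q \<U>)"
    have "?N \<le> card P ^ card F"
    proof (rule subcover_number_le_itineraries[OF action_continuous_on(2)[OF act] P finF _ \<delta>(2)])
      fix x y m
      assume xy: "x \<in> X" "y \<in> X" and cl: "\<And>n. n \<in> F \<Longrightarrow> dist (\<beta> n x) (\<beta> n y) \<le> \<epsilon>" and m: "m \<in> Q"
      have "i \<in> F" if "i \<in> lattice_points (thicken V s)" "norm (real_vec i) \<le> real (L * n)" for i
        using that by (auto simp: F_def intro: order_trans)
      then show "dist (\<beta> m x) (\<beta> m y) < \<delta>"
        by (intro L[rule_format, OF n xy _ Q[OF m]] cl)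
    qed
    then have "real ?N \<le> real (card P) ^ card F" by (metis of_nat_le_iff of_nat_power)
    also have "\<dots> \<le> p ^ card F" by (intro power_mono) (auto simp: p_def)
    also have "\<dots> \<le> p ^ (K * ((L + 1) * n) ^ k)"
      using K[of "(L + 1) * n"] n unfolding F_def by (intro power_increasing) (auto simp: p_def)
    finally have le: "real ?N \<le> p ^ (K * ((L + 1) * n) ^ k)" .
    have p0: "0 < p" by (simp add: p_def)
    have "ln (real ?N) \<le> real (K * ((L + 1) * n) ^ k) * ln p"
    proof (cases "?N = 0")
      case True
      then show ?thesis by (simp add: p_def)
    next
      case False
      then have "ln (real ?N) \<le> ln (p ^ (K * ((L + 1) * n) ^ k))" using le p0 by (subst ln_le_cancel_iff) auto
      then show ?thesis using p0 by (simp add: ln_realpow)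
    qed
    then show ?thesis
      by (simp only: C_def of_nat_mult of_nat_power power_mult_distrib mult_ac)
  qed
  then show ?thesis using that[OF C0] by blast
qed

lemma int_cube_norm_le:
  fixes b :: "(int ^ 'd::finite) list"
  obtains a :: nat where "\<And>n m. m \<in> int_cube b n \<Longrightarrow> norm (real_vec m) \<le> real (a * n)"
proof -
  obtain a :: nat where a: "(\<Sum>i<length b. norm (real_vec (b ! i))) \<le> real a"
    using real_arch_simple by blast
  show ?thesis
  proof (rule that)
    fix n m assume "m \<in> int_cube b n"
    then obtain c where m: "m = int_comb b c" and c: "\<And>i. i < length b \<Longrightarrow> 0 \<le> c i \<and> c i < int n"
      by (auto simp: int_cube_def)
    have "norm (real_vec m) \<le> (\<Sum>i<length b. norm (real_vec (c i *s b ! i)))"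
      unfolding m int_comb_def real_vec_sum by (rule norm_sum)
    also have "\<dots> \<le> (\<Sum>i<length b. real n * norm (real_vec (b ! i)))"
    proof (rule sum_mono)
      fix i assume "i \<in> {..<length b}"
      then have "\<bar>real_of_int (c i)\<bar> \<le> real n" using c[of i] by simp
      then show "norm (real_vec (c i *s b ! i)) \<le> real n * norm (real_vec (b ! i))"
        by (simp add: real_vec_smult mult_right_mono)
    qed
    also have "\<dots> \<le> real n * real a"
      unfolding sum_distrib_left[symmetric] using a by (intro mult_left_mono) auto
    finally show "norm (real_vec m) \<le> real (a * n)" by (simp add: mult.commute)
  qed
qed

lemma tuple_entropy_le_0:
  fixes X :: "'a::metric_space set" and \<beta> :: "int ^ 'd::finite \<Rightarrow> 'a \<Rightarrow> 'a"
  assumes X: "compact X" and act: "topological_action X \<beta>"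
    and V: "V \<in> expansive_planes X \<beta> k" and b: "k < length b"
  shows "tuple_entropy X \<beta> b \<le> 0"
  unfolding tuple_entropy_def
proof (rule SUP_least)
  fix \<U> assume U: "\<U> \<in> open_covers X"
  define h where "h n = ln (real (subcover_number X (refined_cover X \<beta> (int_cube b n) \<U>))) / real (n ^ length b)" for n
  obtain a where a: "\<And>n m. m \<in> int_cube b n \<Longrightarrow> norm (real_vec m) \<le> real (a * n)"
    using int_cube_norm_le[of b] by blast
  obtain C where C: "0 \<le> C" "\<And>n Q. 1 \<le> n \<Longrightarrow> (\<And>m. m \<in> Q \<Longrightarrow> norm (real_vec m) \<le> real (a * n)) \<Longrightarrow>
       ln (real (subcover_number X (refined_cover X \<beta> Q \<U>))) \<le> C * real n ^ k"
    using expansive_plane_complexity[OF X act V U, of a] by blast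
  have h: "h n \<le> C / real n" if n: "1 \<le> n" for n
  proof -
    have "h n \<le> C * real n ^ k / real (n ^ length b)"
      unfolding h_def using C(2)[OF n a] by (intro divide_right_mono) auto
    also have "\<dots> \<le> C * real n ^ k / real n ^ Suc k"
    proof (rule divide_left_mono)
      show "real n ^ Suc k \<le> real (n ^ length b)"
        unfolding of_nat_power by (rule power_increasing) (use b n in auto)
    qed (use C(1) n in auto)
    also have "\<dots> = C / real n" using n by simp
    finally show ?thesis .
  qed
  have lim: "(\<lambda>n. ereal (C / real n)) \<longlonglongrightarrow> ereal 0"
    using lim_const_over_n[of C] by (rule tendsto_ereal)
  have "limsup (\<lambda>n. ereal (h n)) \<le> limsup (\<lambda>n. ereal (C / real n))"
    by (rule Limsup_mono) (use h in \<open>auto intro!: eventually_sequentiallyI[of 1]\<close>)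
  also have "\<dots> = 0" using lim_imp_Limsup[OF _ lim] by (simp add: zero_ereal_def)
  finally show "limsup (\<lambda>n. ereal (ln (real (subcover_number X (refined_cover X \<beta> (int_cube b n) \<U>)))
        / real (n ^ length b))) \<le> 0" by (simp only: h_def)
qed

section \<open>Integral bases of subgroups\<close>

lemma int_comb_Cons: "int_comb (v # b) c = c 0 *s v + int_comb b (\<lambda>i. c (Suc i))"
  by (simp add: int_comb_def sum.lessThan_Suc_shift del: sum.lessThan_Suc)

text \<open>
  Induction on the set of coordinates that may be nonzero on \<open>\<Gamma>\<close>. The \<open>i\<close>-th coordinates of the elements of
  \<open>\<Gamma>\<close> form an ideal of \<open>\<int>\<close>; an element \<open>v\<close> whose \<open>i\<close>-th coordinate generates it, put before a basis of the
  elements with vanishing \<open>i\<close>-th coordinate, is a basis of \<open>\<Gamma>\<close>.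
\<close>

lemma ex_int_basis:
  fixes \<Gamma> :: "(int ^ 'd::finite) set"
  assumes "0 \<in> \<Gamma>" "\<And>m n. m \<in> \<Gamma> \<Longrightarrow> n \<in> \<Gamma> \<Longrightarrow> m + n \<in> \<Gamma>"
    and "\<And>c m. m \<in> \<Gamma> \<Longrightarrow> c *s m \<in> \<Gamma>"
  shows "\<exists>b. int_basis b \<Gamma>"
proof -
  have "\<exists>b. int_basis b \<Gamma>" if "finite S"
      "0 \<in> \<Gamma>" "\<And>m n. m \<in> \<Gamma> \<Longrightarrow> n \<in> \<Gamma> \<Longrightarrow> m + n \<in> \<Gamma>" "\<And>c m. m \<in> \<Gamma> \<Longrightarrow> c *s m \<in> \<Gamma>"
      "\<And>m i. m \<in> \<Gamma> \<Longrightarrow> i \<notin> S \<Longrightarrow> m $ i = 0" for \<Gamma> :: "(int ^ 'd) set" and S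
    using that
  proof (induction S arbitrary: \<Gamma> rule: finite_induct)
    case empty
    then have "\<Gamma> = {0}" by (auto simp: vec_eq_iff)
    then have "int_basis [] \<Gamma>" by (auto simp: int_basis_def int_comb_def)
    then show ?case by blast
  next
    case (insert i S)
    define \<Gamma>' where "\<Gamma>' = {m \<in> \<Gamma>. m $ i = 0}"
    have "\<exists>b. int_basis b \<Gamma>'"
    proof (rule insert.IH)
      show "m $ j = 0" if "m \<in> \<Gamma>'" "j \<notin> S" for m j
        using that insert.prems(4)[of m j] by (cases "j = i") (auto simp: \<Gamma>'_def)
    qed (use insert.prems in \<open>auto simp: \<Gamma>'_def\<close>)
    then obtain b where b: "int_basis b \<Gamma>'" by blast
    show ?case
    proof (cases "\<Gamma>' = \<Gamma>")
      case True
      then show ?thesis using b by blast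
    next
      case False
      then obtain u where u: "u \<in> \<Gamma>" "u $ i \<noteq> 0" by (auto simp: \<Gamma>'_def)
      define Pr where "Pr g \<longleftrightarrow> 0 < g \<and> (\<exists>v\<in>\<Gamma>. v $ i = int g)" for g :: nat
      have "Pr (nat \<bar>u $ i\<bar>)"
      proof -
        have "sgn (u $ i) *s u \<in> \<Gamma>" by (rule insert.prems(3)) (rule u)
        moreover have "(sgn (u $ i) *s u) $ i = int (nat \<bar>u $ i\<bar>)" by (auto simp: sgn_if)
        ultimately show ?thesis
          using u(2) unfolding Pr_def by (intro conjI bexI[of _ "sgn (u $ i) *s u"]) simp_all
      qed
      then have "Pr (LEAST g. Pr g)" by (rule LeastI)
      then obtain v where v: "v \<in> \<Gamma>" "v $ i = int (LEAST g. Pr g)" "0 < v $ i" by (auto simp: Pr_def)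
      have dvd: "v $ i dvd m $ i" if "m \<in> \<Gamma>" for m
      proof (rule ccontr)
        assume nd: "\<not> v $ i dvd m $ i"
        define r where "r = m $ i mod v $ i"
        have "r \<noteq> 0" using nd by (simp add: r_def dvd_eq_mod_eq_0)
        moreover have "0 \<le> r" "r < v $ i" using v(3) by (simp_all add: r_def)
        ultimately have r: "0 < r" "r < v $ i" by simp_all
        have "m + (- (m $ i div v $ i)) *s v \<in> \<Gamma>" by (intro insert.prems(2,3) that v(1))
        moreover have "(m + (- (m $ i div v $ i)) *s v) $ i = r"
          by (simp add: r_def minus_div_mult_eq_mod)
        ultimately have "Pr (nat r)"
          unfolding Pr_def using r(1)
          by (intro conjI bexI[of _ "m + (- (m $ i div v $ i)) *s v"]) simp_all
        then have "(LEAST g. Pr g) \<le> nat r" by (rule Least_le)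
        then show False using r v(2) by linarith
      qed
      have comb_b: "int_comb b c \<in> \<Gamma>'" for c using b by (auto simp: int_basis_def)
      have "range (int_comb (v # b)) = \<Gamma>"
      proof
        show "range (int_comb (v # b)) \<subseteq> \<Gamma>"
          using comb_b v(1) insert.prems(2,3) by (fastforce simp: int_comb_Cons \<Gamma>'_def)
        show "\<Gamma> \<subseteq> range (int_comb (v # b))"
        proof
          fix m assume m: "m \<in> \<Gamma>"
          then obtain q where q: "m $ i = v $ i * q" using dvd by (meson dvdE)
          have "m + (- q) *s v \<in> \<Gamma>" by (intro insert.prems(2,3) m v(1))
          then have "m + (- q) *s v \<in> \<Gamma>'" by (simp add: \<Gamma>'_def q)
          then obtain c where "m + (- q) *s v = int_comb b c" using b by (auto simp: int_basis_def)
          then have "m = int_comb (v # b) (case_nat q c)"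
            by (simp add: int_comb_Cons vec_eq_iff algebra_simps)
          then show "m \<in> range (int_comb (v # b))" by blast
        qed
      qed
      moreover have "\<forall>j<length (v # b). c j = 0" if "int_comb (v # b) c = 0" for c
      proof -
        have "c 0 *s v + int_comb b (\<lambda>i. c (Suc i)) = 0" using that by (simp add: int_comb_Cons)
        then have *: "(c 0 *s v) $ i + int_comb b (\<lambda>i. c (Suc i)) $ i = 0"
          by (metis vector_add_component zero_index)
        have c0: "c 0 = 0" using * comb_b[of "\<lambda>i. c (Suc i)"] v(3) by (simp add: \<Gamma>'_def)
        then have "int_comb b (\<lambda>i. c (Suc i)) = 0" using that by (simp add: int_comb_Cons)
        then have "\<forall>j<length b. c (Suc j) = 0" using b by (auto simp: int_basis_def)
        then show ?thesis using c0 by (auto simp: less_Suc_eq_0_disj)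
      qed
      ultimately show ?thesis unfolding int_basis_def by blast
    qed
  qed
  from this[of UNIV \<Gamma>] assms show ?thesis by simp
qed

lemma dim_le_length_int_basis:
  assumes V: "rational_subspace V" and b: "int_basis b (lattice_points V)"
  shows "dim V \<le> length b"
proof -
  have "real_vec (int_comb b c) \<in> span (real_vec ` set b)" for c
    unfolding int_comb_def real_vec_sum real_vec_smult
    by (intro span_sum span_mul span_base) simp
  then have "real_vec ` range (int_comb b) \<subseteq> span (real_vec ` set b)" by blast
  then have "real_vec ` lattice_points V \<subseteq> span (real_vec ` set b)"
    using b by (simp add: int_basis_def)
  then have "dim (real_vec ` lattice_points V) \<le> card (real_vec ` set b)"
    by (rule dim_le_card) simp
  also have "\<dots> \<le> card (set b)" by (rule card_image_le) simp
  also have "\<dots> \<le> length b" by (rule card_length)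
  finally show ?thesis using V dim_span[of "real_vec ` lattice_points V"]
    by (simp add: rational_subspace_def)
qed

lemma entropy_dims_le_expansive_plane:
  fixes X :: "'a::metric_space set" and \<beta> :: "int ^ 'd::finite \<Rightarrow> 'a \<Rightarrow> 'a"
  assumes X: "compact X" and act: "topological_action X \<beta>"
    and V: "V \<in> expansive_planes X \<beta> k" and l: "l \<in> entropy_dims X \<beta>"
  shows "l \<le> k"
proof (rule ccontr)
  assume "\<not> l \<le> k"
  obtain W where W: "subspace W" "dim W = l" "rational_subspace W"
    and pos: "subgroup_entropy X \<beta> (lattice_points W) > 0"
    using l by (auto simp: entropy_dims_def planes_def)
  define b where "b = (SOME b. int_basis b (lattice_points W))"
  have "\<exists>b. int_basis b (lattice_points W)"
    by (rule ex_int_basis)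
      (use W(1) in \<open>auto simp: lattice_points_def real_vec_0 real_vec_add real_vec_smult
        subspace_0 subspace_add subspace_scale\<close>)
  then have "int_basis b (lattice_points W)" unfolding b_def by (rule someI_ex)
  then have "k < length b" using dim_le_length_int_basis[OF W(3)] W(2) \<open>\<not> l \<le> k\<close> by fastforce
  then have "tuple_entropy X \<beta> b \<le> 0" by (rule tuple_entropy_le_0[OF X act V])
  then show False using pos by (simp add: subgroup_entropy_def b_def)
qed

theorem proposition7p2:
  fixes X :: "'a::metric_space set"
    and \<beta> :: "int ^ 'd::finite \<Rightarrow> 'a \<Rightarrow> 'a"
  assumes "compact X" and "infinite X"
    and "topological_action X \<beta>"
  shows "entrk X \<beta> \<le> exprk X \<beta>"
proof -
  have dim: "l \<le> CARD('d)" if "l \<in> entropy_dims X \<beta>" for l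
    using that by (auto simp: entropy_dims_def planes_def intro: order_trans[OF dim_subset_UNIV_cart])
  have le: "l \<le> exprk X \<beta>" if l: "l \<in> entropy_dims X \<beta>" for l
  proof (cases "expansive X \<beta>")
    case True
    then have "UNIV \<in> expansive_planes X \<beta> CARD('d)"
      by (simp add: expansive_planes_def planes_def expansive_def)
    then have "expansive_planes X \<beta> (exprk X \<beta>) \<noteq> {}"
      unfolding exprk_def using True
      by (simp, intro LeastI[of "\<lambda>k. expansive_planes X \<beta> k \<noteq> {}"]) blast
    then show ?thesis using entropy_dims_le_expansive_plane[OF assms(1,3) _ l] by blast
  next
    case False
    then show ?thesis using dim[OF l] by (simp add: exprk_def)
  qed
  have "entropy_dims X \<beta> \<subseteq> {..CARD('d)}" using dim by auto
  then have "finite (entropy_dims X \<beta>)" by (rule finite_subset) simp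
  then show ?thesis using le by (simp add: entrk_def)
qed

end
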